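(* Assume $\lim_{|x|\to0}\frac{|Q(x)|}{|x|}=0$, that $d=d(x)$ is a nonlinear function of the state, and that a set $\mathcal Q\subseteq\mathbb R^n$ and a scalar $\delta>0$ are known such that $|d(x)|\le\delta$ for all $x\in\mathcal Q$. Consider an experiment on the system such that $x(k)\in\mathcal Q$ for $k=0,\dots,T-1$. Let $\Omega\succ0$ ($\Omega\in\mathbb S^{n\times n}$) be given and set $\Delta:=\delta\sqrt T\,I_s$. Suppose the following program is feasible: minimize $\|X_1G_2\|$ over $P_1\in\mathbb S^{n\times n}$, $Y_1\in\mathbb R^{T\times n}$, $G_2\in\mathbb R^{T\times(S-n)}$, $\epsilon>0$ subject to $$Z_0Y_1=\begin{bmatrix}P_1\\ 0_{(S-n)\times n}\end{bmatrix},\qquad Z_0G_2=\begin{bmatrix}0_{n\times(S-n)}\\ I_{S-n}\end{bmatrix},$$ $$\begin{bmatrix}P_1-\Omega&(X_1Y_1)^\top&Y_1^\top\\ X_1Y_1&P_1-\epsilon E\Delta\Delta^\top E^\top&0_{n\times T}\\ Y_1&0_{T\times n}&\epsilon I_T\end{bmatrix}\succ0 .$$ For any feasible point apply $u=KZ(x)$ with $K=U_0\begin{bmatrix}G_1&G_2\end{bmatrix}$, $G_1:=Y_1P_1^{-1}$. Let $V(x):=x^\top P_1^{-1}x$ and $\mathcal R_\gamma:=\{x:V(x)\le\gamma\}$ with $\gamma>0$ arbitrary. With $\ell(x)$ and $g(x,\delta)$ as defined in the context, let $\mathcal X:=\{x\in\mathbb R^n:\ell(x)+g(x,\delta)\le0\}$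 and $\mathcal Z:=\mathcal R_\gamma\cap\mathcal X^c$. If $\mathcal R_\gamma\subseteq\mathcal Q$ and $$V(x)+\ell(x)+g(x,\delta)\le\gamma\qquad\forall x\in\mathcal Z,$$ then $\mathcal R_\gamma$ is a positively invariant set for the closed-loop system $x^+=AZ(x)+BKZ(x)+Ed(x)$.
   Context: Let $n,m,s,S,T$ be positive integers with $S\ge n$ (blocks of zero size are absent when $S=n$). Consider the discrete-time system $x^+=AZ(x)+Bu+Ed$, with $x\in\mathbb R^n$, $u\in\mathbb R^m$, constant matrices $A\in\mathbb R^{n\times S}$, $B\in\mathbb R^{n\times m}$ (unknown), $E\in\mathbb R^{n\times s}$ (known), $Z(x)=\begin{bmatrix}x\\ Q(x)\end{bmatrix}$ with known $Q:\mathbb R^n\to\mathbb R^{S-n}$, and $d=d(x)\in\mathbb R^s$ an unknown function of the state (neglected nonlinearity). Data: samples satisfying $x(k+1)=AZ(x(k))+Bu(k)+Ed(x(k))$ for $k=0,\dots,T-1$. Define $U_0=[u(0)\ \cdots\ u(T-1)]$, $X_1=[x(1)\ \cdots\ x(T)]$, $Z_0=[Z(x(0))\ \cdots\ Z(x(T-1))]$. With $\underline\Phi:=P_1^{-1}\Omega P_1^{-1}$, define $\ell(x):=-x^\top\underline\Phi x+\ell_1(x)+\ell_2(x)+\ell_3(x)+\ell_4(x)$, where $\ell_1(x):=(2X_1G_1x+X_1G_2Q(x))^\top P_1^{-1}X_1G_2Q(x)$, $\ell_2(x):=\|\Delta\|_2\,|(2X_1G_1x+X_1G_2Q(x))^\top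 P_1^{-1}E|\,|G_2Q(x)|$, $\ell_3(x):=\|\Delta\|_2\,|2G_1x+G_2Q(x)|\,|E^\top P_1^{-1}X_1G_2Q(x)|$, $\ell_4(x):=\|\Delta\|_2^2\,\|E^\top P_1^{-1}E\|_2\,|2G_1x+G_2Q(x)|\,|G_2Q(x)|$; and $g(x,\delta):=r_1(x)\delta+r_2(x)\delta+r_3\delta^2$, where $r_1(x):=2|(X_1G_1x+X_1G_2Q(x))^\top P_1^{-1}E|$, $r_2(x):=2\|\Delta\|_2\|E^\top P_1^{-1}E\|_2\,|G_1x+G_2Q(x)|$, $r_3:=\|E^\top P_1^{-1}E\|_2$. $\mathcal X^c$ is the complement of $\mathcal X$ in $\mathbb R^n$. A set $\mathcal S$ is positively invariant for $x^+=f(x)$ if every solution with $x(0)\in\mathcal S$ satisfies $x(t)\in\mathcal S$ for all $t>0$. $\mathbb S^{n\times n}$: real symmetric matrices; $\succ$: positive definite order; $|\cdot|$: Euclidean norm; $\|\cdot\|_2$: induced 2-norm; $\|\cdot\|$: any matrix norm. *)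

theory Defs
  imports Complex_Main "HOL-Library.FuncSet"
    "Jordan_Normal_Form.Matrix" "Jordan_Normal_Form.Gauss_Jordan_Elimination"
begin

text \<open>Carrier-based matrices are used throughout because the block of dimension \<open>S - n\<close>
  may be empty.\<close>

definition eucl_norm :: "real vec \<Rightarrow> real" where
  "eucl_norm v = sqrt (v \<bullet> v)"

definition induced_norm :: "real mat \<Rightarrow> real" where
  "induced_norm M = (SUP v\<in>{v \<in> carrier_vec (dim_col M). eucl_norm v \<le> 1}. eucl_norm (M *\<^sub>v v))"

definition sym_mat :: "nat \<Rightarrow> real mat \<Rightarrow> bool" where
  "sym_mat k M \<longleftrightarrow> M \<in> carrier_mat k k \<and> transpose_mat M = M"

definition pos_def :: "nat \<Rightarrow> real mat \<Rightarrow> bool" where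
  "pos_def k M \<longleftrightarrow> sym_mat k M \<and> (\<forall>v\<in>carrier_vec k. v \<noteq> 0\<^sub>v k \<longrightarrow> 0 < v \<bullet> (M *\<^sub>v v))"

text \<open>Total version of the library's partial inverse; unspecified on singular matrices.\<close>

definition minv :: "real mat \<Rightarrow> real mat" where
  "minv M = the (mat_inverse M)"

definition append_cols :: "real mat \<Rightarrow> real mat \<Rightarrow> real mat" where
  "append_cols M N = transpose_mat (transpose_mat M @\<^sub>r transpose_mat N)"

definition three_block_mat ::
  "real mat \<Rightarrow> real mat \<Rightarrow> real mat \<Rightarrow> real mat \<Rightarrow> real mat \<Rightarrow> real mat \<Rightarrow>
   real mat \<Rightarrow> real mat \<Rightarrow> real mat \<Rightarrow> real mat" where
  "three_block_mat M11 M12 M13 M21 M22 M23 M31 M32 M33 =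
     four_block_mat M11 (append_cols M12 M13) (M21 @\<^sub>r M31) (four_block_mat M22 M23 M32 M33)"

text \<open>The regressor \<open>Z(x) = (x, Q(x))\<close>.\<close>

definition lift_state :: "(real vec \<Rightarrow> real vec) \<Rightarrow> real vec \<Rightarrow> real vec" where
  "lift_state Q x = x @\<^sub>v Q x"

definition positively_invariant :: "('a \<Rightarrow> 'a) \<Rightarrow> 'a set \<Rightarrow> bool" where
  "positively_invariant f M \<longleftrightarrow>
     (\<forall>x :: nat \<Rightarrow> 'a. x 0 \<in> M \<longrightarrow> (\<forall>t. x (Suc t) = f (x t)) \<longrightarrow> (\<forall>t>0. x t \<in> M))"

text \<open>Constraint set, in the decision variables \<open>P1\<close>, \<open>Y1\<close>, \<open>G2\<close>, \<open>\<epsilon>\<close>, of the program that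
  minimises a norm of \<open>X1 G2\<close>. The objective does not affect feasibility.\<close>

definition feasible_point ::
  "nat \<Rightarrow> nat \<Rightarrow> nat \<Rightarrow> real mat \<Rightarrow> real mat \<Rightarrow> real mat \<Rightarrow> real mat \<Rightarrow> real mat \<Rightarrow>
   real mat \<Rightarrow> real mat \<Rightarrow> real mat \<Rightarrow> real \<Rightarrow> bool" where
  "feasible_point n S T X1 Z0 E \<Delta> \<Omega> P1 Y1 G2 \<epsilon> \<longleftrightarrow>
     sym_mat n P1 \<and> Y1 \<in> carrier_mat T n \<and> G2 \<in> carrier_mat T (S - n) \<and> 0 < \<epsilon> \<and>
     Z0 * Y1 = (P1 @\<^sub>r 0\<^sub>m (S - n) n) \<and>
     Z0 * G2 = (0\<^sub>m n (S - n) @\<^sub>r 1\<^sub>m (S - n)) \<and>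
     pos_def (n + (n + T))
       (three_block_mat
          (P1 - \<Omega>)  (transpose_mat (X1 * Y1))                                          (transpose_mat Y1)
          (X1 * Y1) (P1 - \<epsilon> \<cdot>\<^sub>m (E * \<Delta> * transpose_mat \<Delta> * transpose_mat E)) (0\<^sub>m n T)
          Y1        (0\<^sub>m T n)                                                          (\<epsilon> \<cdot>\<^sub>m 1\<^sub>m T))"

definition lyap :: "real mat \<Rightarrow> real vec \<Rightarrow> real" where
  "lyap P1 x = x \<bullet> (minv P1 *\<^sub>v x)"

definition sublevel :: "nat \<Rightarrow> real mat \<Rightarrow> real \<Rightarrow> real vec set" where
  "sublevel n P1 \<gamma> = {x \<in> carrier_vec n. lyap P1 x \<le> \<gamma>}"

text \<open>Below, the norm of a row vector \<open>w\<^sup>T M\<close> is written as the Euclidean norm of its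
  transpose \<open>M\<^sup>T w\<close>. The argument \<open>q\<close> stands for the value \<open>Q(x)\<close>.\<close>

definition ell1 :: "real mat \<Rightarrow> real mat \<Rightarrow> real mat \<Rightarrow> real mat \<Rightarrow> real vec \<Rightarrow> real vec \<Rightarrow> real" where
  "ell1 X1 P1 G1 G2 x q =
     (2 \<cdot>\<^sub>v (X1 * G1 *\<^sub>v x) + X1 * G2 *\<^sub>v q) \<bullet> (minv P1 *\<^sub>v (X1 * G2 *\<^sub>v q))"

definition ell2 ::
  "real mat \<Rightarrow> real mat \<Rightarrow> real mat \<Rightarrow> real mat \<Rightarrow> real mat \<Rightarrow> real mat \<Rightarrow>
   real vec \<Rightarrow> real vec \<Rightarrow> real" where
  "ell2 X1 E \<Delta> P1 G1 G2 x q =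
     induced_norm \<Delta>
     * eucl_norm (transpose_mat (minv P1 * E) *\<^sub>v (2 \<cdot>\<^sub>v (X1 * G1 *\<^sub>v x) + X1 * G2 *\<^sub>v q))
     * eucl_norm (G2 *\<^sub>v q)"

definition ell3 ::
  "real mat \<Rightarrow> real mat \<Rightarrow> real mat \<Rightarrow> real mat \<Rightarrow> real mat \<Rightarrow> real mat \<Rightarrow>
   real vec \<Rightarrow> real vec \<Rightarrow> real" where
  "ell3 X1 E \<Delta> P1 G1 G2 x q =
     induced_norm \<Delta>
     * eucl_norm (2 \<cdot>\<^sub>v (G1 *\<^sub>v x) + G2 *\<^sub>v q)
     * eucl_norm (transpose_mat E * minv P1 * X1 * G2 *\<^sub>v q)"

definition ell4 ::
  "real mat \<Rightarrow> real mat \<Rightarrow> real mat \<Rightarrow> real mat \<Rightarrow> real mat \<Rightarrow> real vec \<Rightarrow> real vec \<Rightarrow> real" where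
  "ell4 E \<Delta> P1 G1 G2 x q =
     (induced_norm \<Delta>)\<^sup>2 * induced_norm (transpose_mat E * minv P1 * E)
     * eucl_norm (2 \<cdot>\<^sub>v (G1 *\<^sub>v x) + G2 *\<^sub>v q) * eucl_norm (G2 *\<^sub>v q)"

definition ell ::
  "(real vec \<Rightarrow> real vec) \<Rightarrow> real mat \<Rightarrow> real mat \<Rightarrow> real mat \<Rightarrow> real mat \<Rightarrow>
   real mat \<Rightarrow> real mat \<Rightarrow> real mat \<Rightarrow> real vec \<Rightarrow> real" where
  "ell Q X1 E \<Delta> \<Omega> P1 G1 G2 x =
     - (x \<bullet> (minv P1 * \<Omega> * minv P1 *\<^sub>v x))
     + ell1 X1 P1 G1 G2 x (Q x) + ell2 X1 E \<Delta> P1 G1 G2 x (Q x)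
     + ell3 X1 E \<Delta> P1 G1 G2 x (Q x) + ell4 E \<Delta> P1 G1 G2 x (Q x)"

definition r1 ::
  "real mat \<Rightarrow> real mat \<Rightarrow> real mat \<Rightarrow> real mat \<Rightarrow> real mat \<Rightarrow> real vec \<Rightarrow> real vec \<Rightarrow> real" where
  "r1 X1 E P1 G1 G2 x q =
     2 * eucl_norm (transpose_mat (minv P1 * E) *\<^sub>v (X1 * G1 *\<^sub>v x + X1 * G2 *\<^sub>v q))"

definition r2 ::
  "real mat \<Rightarrow> real mat \<Rightarrow> real mat \<Rightarrow> real mat \<Rightarrow> real mat \<Rightarrow> real vec \<Rightarrow> real vec \<Rightarrow> real" where
  "r2 E \<Delta> P1 G1 G2 x q =
     2 * induced_norm \<Delta> * induced_norm (transpose_mat E * minv P1 * E)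
     * eucl_norm (G1 *\<^sub>v x + G2 *\<^sub>v q)"

definition r3 :: "real mat \<Rightarrow> real mat \<Rightarrow> real" where
  "r3 E P1 = induced_norm (transpose_mat E * minv P1 * E)"

definition g_bound ::
  "(real vec \<Rightarrow> real vec) \<Rightarrow> real mat \<Rightarrow> real mat \<Rightarrow> real mat \<Rightarrow> real mat \<Rightarrow>
   real mat \<Rightarrow> real mat \<Rightarrow> real vec \<Rightarrow> real \<Rightarrow> real" where
  "g_bound Q X1 E \<Delta> P1 G1 G2 x \<delta> =
     r1 X1 E P1 G1 G2 x (Q x) * \<delta> + r2 E \<Delta> P1 G1 G2 x (Q x) * \<delta> + r3 E P1 * \<delta>\<^sup>2"

end

theory Submission
  imports Defs "HOL-Analysis.L2_Norm" "Jordan_Normal_Form.Determinant"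
begin

text \<open>With \<open>D\<close> the matrix of the unknown samples \<open>d(x(0)), \<dots>, d(x(T - 1))\<close>, the data satisfy
  \<open>X\<^sub>1 = A Z\<^sub>0 + B U\<^sub>0 + E D\<close>, and \<open>Z\<^sub>0 [G\<^sub>1 G\<^sub>2] = I\<close>, so the closed loop reads
  \<open>x\<^sup>+ = (X\<^sub>1 - E D) (G\<^sub>1 x + G\<^sub>2 Q(x)) + E d(x)\<close> with \<open>|D w| \<le> \<parallel>\<Delta>\<parallel> |w|\<close>. The linear part
  decreases \<open>V\<close> by \<open>x\<^sup>T \<Phi> x\<close>, where \<open>\<Phi> = P\<^sub>1\<^sup>-\<^sup>1 \<Omega> P\<^sub>1\<^sup>-\<^sup>1\<close>: evaluate the matrix inequality at \<open>(P\<^sub>1\<^sup>-\<^sup>1 x, v, - D\<^sup>T E\<^sup>T v)\<close>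
  with \<open>v = - P\<^sub>1\<^sup>-\<^sup>1 (X\<^sub>1 - E D) G\<^sub>1 x\<close>. The remaining terms of \<open>V(x\<^sup>+)\<close> are bounded by Cauchy-Schwarz,
  which gives \<open>V(x\<^sup>+) \<le> V(x) + \<ell>(x) + g(x, \<delta>)\<close> on the sublevel set.\<close>

section \<open>Euclidean and induced norms, and the size of the matrix of unknown samples\<close>

lemma eucl_norm_eq_L2_set: "eucl_norm v = L2_set (\<lambda>i. v $ i) {0..<dim_vec v}"
  by (simp add: eucl_norm_def L2_set_def scalar_prod_def power2_eq_square)

lemma scalar_prod_self_nonneg: "0 \<le> v \<bullet> (v :: real vec)"
  by (simp add: scalar_prod_def sum_nonneg)

lemma eucl_norm_nonneg [simp]: "0 \<le> eucl_norm v"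
  by (simp add: eucl_norm_def scalar_prod_self_nonneg)

lemma eucl_norm_square: "(eucl_norm v)\<^sup>2 = v \<bullet> v"
  by (simp add: eucl_norm_def scalar_prod_self_nonneg)

lemma abs_scalar_prod_le:
  assumes "u \<in> carrier_vec n" "v \<in> carrier_vec n"
  shows "\<bar>u \<bullet> v\<bar> \<le> eucl_norm u * eucl_norm v"
proof -
  have "\<bar>u \<bullet> v\<bar> \<le> (\<Sum>i\<in>{0..<n}. \<bar>u $ i\<bar> * \<bar>v $ i\<bar>)"
    using assms by (auto simp: scalar_prod_def abs_mult[symmetric])
  also have "\<dots> \<le> eucl_norm u * eucl_norm v"
    using assms L2_set_mult_ineq[of "\<lambda>i. u $ i" "\<lambda>i. v $ i"] by (auto simp: eucl_norm_eq_L2_set)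
  finally show ?thesis .
qed

lemma eucl_norm_smult: "eucl_norm (c \<cdot>\<^sub>v v) = \<bar>c\<bar> * eucl_norm v"
  by (simp add: eucl_norm_def real_sqrt_mult mult.assoc[symmetric])

lemma eucl_norm_eq_0_iff:
  assumes "v \<in> carrier_vec n"
  shows "eucl_norm v = 0 \<longleftrightarrow> v = 0\<^sub>v n"
  using assms by (auto simp: eucl_norm_eq_L2_set L2_set_eq_0_iff)

text \<open>\<open>induced_norm\<close> is a real supremum, which dominates its members only once
  the image of the unit ball is known to be bounded above. Cauchy-Schwarz on every row supplies such
  a bound, the sum of the row norms. The claim then follows by scaling \<open>v\<close> to length
  one; the zero vector cannot be scaled and is treated apart.\<close>

lemma eucl_norm_mult_mat_vec_le:
  assumes M: "M \<in> carrier_mat r k" and v: "v \<in> carrier_vec k"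
  shows "eucl_norm (M *\<^sub>v v) \<le> induced_norm M * eucl_norm v"
proof (cases "v = 0\<^sub>v k")
  case True
  have "M *\<^sub>v 0\<^sub>v k = 0\<^sub>v r" using M by auto
  then show ?thesis using True
    by (simp add: eucl_norm_def)
next
  case False
  let ?B = "{v \<in> carrier_vec (dim_col M). eucl_norm v \<le> 1}"
  let ?C = "\<Sum>i\<in>{0..<r}. eucl_norm (row M i)"
  have "eucl_norm (M *\<^sub>v w) \<le> ?C" if w: "w \<in> ?B" for w
  proof -
    have "eucl_norm (M *\<^sub>v w) \<le> (\<Sum>i\<in>{0..<r}. \<bar>row M i \<bullet> w\<bar>)"
      using L2_set_le_sum_abs[of "\<lambda>i. (M *\<^sub>v w) $ i" "{0..<r}"] M
      by (auto simp: eucl_norm_eq_L2_set)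
    also have "\<dots> \<le> ?C"
    proof (rule sum_mono)
      fix i assume "i \<in> {0..<r}"
      have "\<bar>row M i \<bullet> w\<bar> \<le> eucl_norm (row M i) * eucl_norm w"
        using M w by (intro abs_scalar_prod_le[of _ k]) auto
      also have "\<dots> \<le> eucl_norm (row M i) * 1"
        using w by (intro mult_left_mono) auto
      finally show "\<bar>row M i \<bullet> w\<bar> \<le> eucl_norm (row M i)" by simp
    qed
    finally show ?thesis .
  qed
  then have bdd: "bdd_above ((\<lambda>v. eucl_norm (M *\<^sub>v v)) ` ?B)"
    by (intro bdd_aboveI2) blast
  define c where "c = eucl_norm v"
  have c: "0 < c"
    using False v eucl_norm_eq_0_iff[OF v] eucl_norm_nonneg[of v] unfolding c_def by linarith
  have "(1 / c) \<cdot>\<^sub>v v \<in> ?B"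
    using M v c by (auto simp: eucl_norm_smult c_def)
  then have "eucl_norm (M *\<^sub>v ((1 / c) \<cdot>\<^sub>v v)) \<le> induced_norm M"
    unfolding induced_norm_def by (rule cSUP_upper[OF _ bdd])
  moreover have "M *\<^sub>v ((1 / c) \<cdot>\<^sub>v v) = (1 / c) \<cdot>\<^sub>v (M *\<^sub>v v)"
    using M v by (simp add: mult_mat_vec)
  ultimately show ?thesis
    using c by (simp add: eucl_norm_smult field_simps c_def)
qed

text \<open>This holds because \<open>|D v|^2 = (D^T D v) . v <= c |D v| |v|\<close>, where a
  nonzero factor \<open>|D v|\<close> cancels. It is needed because the samples bound
  \<open>D^T\<close> directly, whereas the closed loop applies \<open>D\<close>.\<close>

lemma eucl_norm_transpose_bound:
  assumes D: "D \<in> carrier_mat s k" and c: "0 \<le> c"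
    and bound: "\<And>z. z \<in> carrier_vec s \<Longrightarrow> eucl_norm (transpose_mat D *\<^sub>v z) \<le> c * eucl_norm z"
    and v: "v \<in> carrier_vec k"
  shows "eucl_norm (D *\<^sub>v v) \<le> c * eucl_norm v"
proof -
  let ?z = "D *\<^sub>v v"
  have z: "?z \<in> carrier_vec s" using D v by auto
  have "(eucl_norm ?z)\<^sup>2 = (transpose_mat D *\<^sub>v ?z) \<bullet> v"
    unfolding eucl_norm_square by (rule transpose_vec_mult_scalar[OF D v z, symmetric])
  also have "\<dots> \<le> eucl_norm (transpose_mat D *\<^sub>v ?z) * eucl_norm v"
    using abs_scalar_prod_le[of "transpose_mat D *\<^sub>v ?z" k v] D v by auto
  also have "\<dots> \<le> (c * eucl_norm ?z) * eucl_norm v"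
    by (intro mult_right_mono bound z) simp
  finally have "eucl_norm ?z * eucl_norm ?z \<le> eucl_norm ?z * (c * eucl_norm v)"
    by (simp add: power2_eq_square algebra_simps)
  then show ?thesis
    using c eucl_norm_nonneg[of ?z] eucl_norm_nonneg[of v]
    by (cases "eucl_norm ?z = 0") (auto simp: mult_le_cancel_left)
qed

text \<open>Each entry of the product is the inner product of one sample with \<open>z\<close>,
  hence at most \<open>\<delta> |z|\<close> in absolute value. Summing the squares over all samples
  produces the square root of their number, which is the origin of the scaling of
  \<open>\<Delta>\<close>.\<close>

lemma eucl_norm_transpose_mat_of_cols_le:
  assumes ds: "set ds \<subseteq> carrier_vec s" and "\<And>w. w \<in> set ds \<Longrightarrow> eucl_norm w \<le> \<delta>"
    and "0 \<le> \<delta>" and z: "z \<in> carrier_vec s"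
  shows "eucl_norm (transpose_mat (mat_of_cols s ds) *\<^sub>v z) \<le> \<delta> * sqrt (real (length ds)) * eucl_norm z"
proof -
  let ?y = "transpose_mat (mat_of_cols s ds) *\<^sub>v z"
  have "\<bar>?y $ k\<bar> \<le> \<delta> * eucl_norm z" if "k < length ds" for k
  proof -
    have dk: "ds ! k \<in> carrier_vec s" using ds that by auto
    have "?y $ k = (ds ! k) \<bullet> z" using that dk by simp
    then have "\<bar>?y $ k\<bar> \<le> eucl_norm (ds ! k) * eucl_norm z"
      using abs_scalar_prod_le[OF dk z] by simp
    also have "\<dots> \<le> \<delta> * eucl_norm z"
      using assms(2) that by (intro mult_right_mono) auto
    finally show ?thesis .
  qed
  then have "(?y $ k)\<^sup>2 \<le> (\<delta> * eucl_norm z)\<^sup>2" if "k < length ds" for k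
    using that by (metis abs_ge_zero power2_abs power_mono)
  then have "(\<Sum>k\<in>{0..<length ds}. (?y $ k)\<^sup>2) \<le> (\<Sum>k\<in>{0..<length ds}. (\<delta> * eucl_norm z)\<^sup>2)"
    by (intro sum_mono) simp
  then have "(eucl_norm ?y)\<^sup>2 \<le> (\<delta> * sqrt (real (length ds)) * eucl_norm z)\<^sup>2"
    by (simp add: eucl_norm_square scalar_prod_def power2_eq_square[symmetric] power_mult_distrib
        algebra_simps del: index_mult_mat_vec)
  then show ?thesis
    by (rule power2_le_imp_le) (use assms in simp)
qed

section \<open>Block matrices, positive definiteness and quadratic forms\<close>

lemma smult_mult_mat_vec:
  fixes M :: "real mat"
  assumes "M \<in> carrier_mat r k" "v \<in> carrier_vec k"
  shows "(c \<cdot>\<^sub>m M) *\<^sub>v v = c \<cdot>\<^sub>v (M *\<^sub>v v)"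
  using assms by (intro eq_vecI) auto

lemma append_cols_mult_vec:
  assumes M: "M \<in> carrier_mat r k" and N: "N \<in> carrier_mat r l"
    and v: "v \<in> carrier_vec k" and w: "w \<in> carrier_vec l"
  shows "append_cols M N *\<^sub>v (v @\<^sub>v w) = M *\<^sub>v v + N *\<^sub>v w"
proof -
  \<comment> \<open>An empty lower block row turns the concatenation into a four-block matrix, so
    that the block product rule applies; the empty half of the product disappears again at the
    end.\<close>
  have "append_cols M N = four_block_mat M N (0\<^sub>m 0 k) (0\<^sub>m 0 l)"
    using M N unfolding append_cols_def append_rows_def
    by (subst transpose_four_block_mat) auto
  then have "append_cols M N *\<^sub>v (v @\<^sub>v w) =
      (M *\<^sub>v v + N *\<^sub>v w) @\<^sub>v (0\<^sub>m 0 k *\<^sub>v v + 0\<^sub>m 0 l *\<^sub>v w)"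
    using four_block_mat_mult_vec[OF M N _ _ v w, of "0\<^sub>m 0 k" 0 "0\<^sub>m 0 l"] by simp
  then show ?thesis
    using M N by (auto intro!: eq_vecI)
qed

lemma append_cols_carrier [simp]:
  "M \<in> carrier_mat r k \<Longrightarrow> N \<in> carrier_mat r l \<Longrightarrow> append_cols M N \<in> carrier_mat r (k + l)"
  unfolding append_cols_def by auto

lemma pos_def_mult_nonneg:
  assumes "pos_def k M" "v \<in> carrier_vec k"
  shows "0 \<le> v \<bullet> (M *\<^sub>v v)"
  using assms by (cases "v = 0\<^sub>v k") (auto simp: pos_def_def sym_mat_def intro: less_imp_le)

text \<open>A nonzero kernel vector would make the quadratic form vanish, so the determinant is
  nonzero and \<open>minv M\<close> is a genuine inverse. Transposing \<open>M * minv M = 1\<close>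
  shows that the transposed inverse is a left inverse of the symmetric \<open>M\<close>, hence equal
  to \<open>minv M\<close>.\<close>

lemma pos_def_imp_minv:
  assumes "pos_def k M"
  shows "minv M \<in> carrier_mat k k" "M * minv M = 1\<^sub>m k" "minv M * M = 1\<^sub>m k"
    "transpose_mat (minv M) = minv M"
proof -
  have M: "M \<in> carrier_mat k k" and sym: "transpose_mat M = M"
    using assms by (auto simp: pos_def_def sym_mat_def)
  have "det M \<noteq> 0"
    using assms unfolding det_0_iff_vec_prod_zero_field[OF M] pos_def_def by fastforce
  then obtain B where "mat_inverse M = Some B"
    using mat_inverse(1)[OF M, of "()"] det_non_zero_imp_unit[OF M, of "()"]
    by (cases "mat_inverse M") auto
  then show inv: "minv M \<in> carrier_mat k k" "M * minv M = 1\<^sub>m k" "minv M * M = 1\<^sub>m k"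
    using mat_inverse(2)[OF M] by (auto simp: minv_def)
  have "transpose_mat (minv M) * M = 1\<^sub>m k"
    using transpose_mult[OF M inv(1)] inv(2) sym by simp
  then have "(transpose_mat (minv M) * M) * minv M = minv M"
    using inv by simp
  moreover have "(transpose_mat (minv M) * M) * minv M = transpose_mat (minv M) * (M * minv M)"
    using M inv(1) by (intro assoc_mult_mat) auto
  ultimately show "transpose_mat (minv M) = minv M"
    using inv by simp
qed

text \<open>This turns the matrix inequality into a scalar one at a chosen test vector. The lower
  right part is itself a four-block matrix, so the block product rule is applied on two
  levels.\<close>

lemma three_block_quadratic_form:
  assumes M: "M11 \<in> carrier_mat k k" "M12 \<in> carrier_mat k l" "M13 \<in> carrier_mat k r"
    "M21 \<in> carrier_mat l k" "M22 \<in> carrier_mat l l" "M23 \<in> carrier_mat l r"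
    "M31 \<in> carrier_mat r k" "M32 \<in> carrier_mat r l" "M33 \<in> carrier_mat r r"
    and v: "x \<in> carrier_vec k" "y \<in> carrier_vec l" "z \<in> carrier_vec r"
  shows "(x @\<^sub>v y @\<^sub>v z) \<bullet> (three_block_mat M11 M12 M13 M21 M22 M23 M31 M32 M33 *\<^sub>v (x @\<^sub>v y @\<^sub>v z)) =
    x \<bullet> (M11 *\<^sub>v x) + x \<bullet> (M12 *\<^sub>v y) + x \<bullet> (M13 *\<^sub>v z) +
    (y \<bullet> (M21 *\<^sub>v x) + y \<bullet> (M22 *\<^sub>v y) + y \<bullet> (M23 *\<^sub>v z)) +
    (z \<bullet> (M31 *\<^sub>v x) + z \<bullet> (M32 *\<^sub>v y) + z \<bullet> (M33 *\<^sub>v z))"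
proof -
  have "three_block_mat M11 M12 M13 M21 M22 M23 M31 M32 M33 *\<^sub>v (x @\<^sub>v y @\<^sub>v z) =
    (M11 *\<^sub>v x + append_cols M12 M13 *\<^sub>v (y @\<^sub>v z)) @\<^sub>v
    ((M21 @\<^sub>r M31) *\<^sub>v x + four_block_mat M22 M23 M32 M33 *\<^sub>v (y @\<^sub>v z))"
    unfolding three_block_mat_def
    by (rule four_block_mat_mult_vec[of _ k k _ "l + r" _ "l + r"]) (use M v in auto)
  also have "append_cols M12 M13 *\<^sub>v (y @\<^sub>v z) = M12 *\<^sub>v y + M13 *\<^sub>v z"
    using M v by (intro append_cols_mult_vec)
  also have "(M21 @\<^sub>r M31) *\<^sub>v x = M21 *\<^sub>v x @\<^sub>v M31 *\<^sub>v x"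
    using M v by (intro mat_mult_append)
  also have "four_block_mat M22 M23 M32 M33 *\<^sub>v (y @\<^sub>v z) =
      (M22 *\<^sub>v y + M23 *\<^sub>v z) @\<^sub>v (M32 *\<^sub>v y + M33 *\<^sub>v z)"
    using M v by (intro four_block_mat_mult_vec)
  also have "(M21 *\<^sub>v x @\<^sub>v M31 *\<^sub>v x) + ((M22 *\<^sub>v y + M23 *\<^sub>v z) @\<^sub>v (M32 *\<^sub>v y + M33 *\<^sub>v z)) =
      (M21 *\<^sub>v x + (M22 *\<^sub>v y + M23 *\<^sub>v z)) @\<^sub>v (M31 *\<^sub>v x + (M32 *\<^sub>v y + M33 *\<^sub>v z))"
    using M v by (intro append_vec_add[of _ l _ _ r]) auto
  finally show ?thesis
    using M v
    by (simp add: scalar_prod_append[of _ k _ "l + r"] scalar_prod_append[of _ l _ r]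
        scalar_prod_add_distrib[of _ k] scalar_prod_add_distrib[of _ l] scalar_prod_add_distrib[of _ r])
qed

lemma scalar_prod_mult_transpose:
  assumes "M \<in> carrier_mat r k" "u \<in> carrier_vec k" "v \<in> carrier_vec r"
  shows "u \<bullet> (transpose_mat M *\<^sub>v v) = v \<bullet> (M *\<^sub>v (u :: real vec))"
proof -
  have "u \<bullet> (transpose_mat M *\<^sub>v v) = (transpose_mat M *\<^sub>v v) \<bullet> u"
    using assms by (intro comm_scalar_prod[of _ k]) auto
  then show ?thesis
    using transpose_vec_mult_scalar[OF assms] by simp
qed

text \<open>The grouping anticipates the roles of the summands: \<open>a\<close> is the linear part
  of the closed loop, \<open>b\<close> the part driven by \<open>Q\<close>, and \<open>e\<close> the
  term \<open>E d(x)\<close>. The first summand of the result is left to the matrix inequality, the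
  second leads to \<open>ell1\<close> to \<open>ell4\<close>, and the last two lead to
  \<open>g_bound\<close>.\<close>

lemma quadratic_form_add3:
  fixes W :: "real mat"
  assumes W: "W \<in> carrier_mat n n" "transpose_mat W = W"
    and v: "a \<in> carrier_vec n" "b \<in> carrier_vec n" "e \<in> carrier_vec n"
  shows "(a + b + e) \<bullet> (W *\<^sub>v (a + b + e)) =
    a \<bullet> (W *\<^sub>v a) + (2 \<cdot>\<^sub>v a + b) \<bullet> (W *\<^sub>v b) + 2 * ((a + b) \<bullet> (W *\<^sub>v e)) + e \<bullet> (W *\<^sub>v e)"
proof -
  have "b \<bullet> (W *\<^sub>v a) = a \<bullet> (W *\<^sub>v b)" "e \<bullet> (W *\<^sub>v a) = a \<bullet> (W *\<^sub>v e)"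
    "e \<bullet> (W *\<^sub>v b) = b \<bullet> (W *\<^sub>v e)"
    using scalar_prod_mult_transpose[OF W(1)] v unfolding W(2) by metis+
  then show ?thesis
    using W(1) v
    by (simp add: mult_add_distrib_mat_vec[of _ n n] add_scalar_prod_distrib[of _ n]
        scalar_prod_add_distrib[of _ n])
qed

section \<open>Consequences of the matrix inequality\<close>

lemma three_block_pos_def_imp_pos_def:
  assumes pd: "pos_def (n + (n + T)) (three_block_mat M11 M12 M13 M21
      (P - \<epsilon> \<cdot>\<^sub>m (E * \<Delta> * transpose_mat \<Delta> * transpose_mat E)) M23 M31 M32 M33)"
    and M: "M11 \<in> carrier_mat n n" "M12 \<in> carrier_mat n n" "M13 \<in> carrier_mat n T"
    "M21 \<in> carrier_mat n n" "M23 \<in> carrier_mat n T"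
    "M31 \<in> carrier_mat T n" "M32 \<in> carrier_mat T n" "M33 \<in> carrier_mat T T"
    and P: "sym_mat n P" and E: "E \<in> carrier_mat n s" and \<Delta>: "\<Delta> \<in> carrier_mat s k" and \<epsilon>: "0 \<le> \<epsilon>"
  shows "pos_def n P"
  unfolding pos_def_def
proof (intro conjI P ballI impI)
  fix v :: "real vec" assume v: "v \<in> carrier_vec n" "v \<noteq> 0\<^sub>v n"
  have Pc: "P \<in> carrier_mat n n" using P by (simp add: sym_mat_def)
  let ?R = "E * \<Delta> * transpose_mat \<Delta> * transpose_mat E"
  have R: "?R \<in> carrier_mat n n" using E \<Delta> by auto
  then have PR: "P - \<epsilon> \<cdot>\<^sub>m ?R \<in> carrier_mat n n" by (intro minus_carrier_mat smult_carrier_mat)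
  \<comment> \<open>At this vector only the middle diagonal block contributes. The entries of
    \<open>v\<close> sit at the indices from \<open>n\<close> on, so the vector is nonzero because
    \<open>v\<close> is.\<close>
  let ?w = "0\<^sub>v n @\<^sub>v v @\<^sub>v 0\<^sub>v T"
  have "?w \<noteq> 0\<^sub>v (n + (n + T))"
  proof
    assume eq: "?w = 0\<^sub>v (n + (n + T))"
    have "v $ i = 0" if "i < n" for i
      using arg_cong[OF eq, of "\<lambda>u. u $ (n + i)"] that v by simp
    then show False using v by (auto intro: eq_vecI)
  qed
  then have "0 < ?w \<bullet> (three_block_mat M11 M12 M13 M21 (P - \<epsilon> \<cdot>\<^sub>m ?R) M23 M31 M32 M33 *\<^sub>v ?w)"
    using pd v unfolding pos_def_def by auto
  moreover have Mv0: "M21 *\<^sub>v 0\<^sub>v n = 0\<^sub>v n" "M23 *\<^sub>v 0\<^sub>v T = 0\<^sub>v n"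
    using M by auto
  ultimately have "0 < v \<bullet> ((P - \<epsilon> \<cdot>\<^sub>m ?R) *\<^sub>v v)"
    using M v PR Mv0 by (subst (asm) three_block_quadratic_form[of _ n _ n _ T]) auto
  also have "(P - \<epsilon> \<cdot>\<^sub>m ?R) *\<^sub>v v = P *\<^sub>v v - \<epsilon> \<cdot>\<^sub>v (?R *\<^sub>v v)"
    using Pc R v by (subst minus_mult_distrib_mat_vec[of _ n n]) (auto simp: smult_mult_mat_vec[of _ n n])
  also have "v \<bullet> (P *\<^sub>v v - \<epsilon> \<cdot>\<^sub>v (?R *\<^sub>v v)) = v \<bullet> (P *\<^sub>v v) - \<epsilon> * (v \<bullet> (?R *\<^sub>v v))"
    using Pc R v by (subst scalar_prod_minus_distrib[of _ n]) auto
  \<comment> \<open>The subtracted matrix has the form \<open>F F^T\<close> with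
    \<open>F = E \<Delta>\<close>, so its quadratic form is a squared norm; as
    \<open>\<epsilon>\<close> is nonnegative, dropping it keeps the form of \<open>P\<close>
    positive.\<close>
  also have "v \<bullet> (?R *\<^sub>v v) = (transpose_mat (E * \<Delta>) *\<^sub>v v) \<bullet> (transpose_mat (E * \<Delta>) *\<^sub>v v)"
  proof -
    define F where "F = E * \<Delta>"
    have F: "F \<in> carrier_mat n k" using E \<Delta> by (simp add: F_def)
    have "?R = F * transpose_mat F"
      unfolding F_def transpose_mult[OF E \<Delta>]
      by (rule assoc_mult_mat[of _ n k _ s _ n]) (use E \<Delta> in auto)
    then have "?R *\<^sub>v v = F *\<^sub>v (transpose_mat F *\<^sub>v v)"
      using F v by simp
    then show ?thesis
      using transpose_vec_mult_scalar[OF F _ v(1), of "transpose_mat F *\<^sub>v v"] F v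
      unfolding F_def by simp
  qed
  finally show "0 < v \<bullet> (P *\<^sub>v v)"
    using mult_nonneg_nonneg[OF \<epsilon> scalar_prod_self_nonneg] by (smt (verit))
qed

text \<open>The decrease holds for every perturbation \<open>D\<close> obeying the bound. Among the
  nine terms of the quadratic form, the off-diagonal ones add up to \<open>- 2 (a . W a)\<close>,
  the middle diagonal one equals \<open>a . W a - \<epsilon> c^2 |z|^2\<close>, and the last
  diagonal one equals \<open>\<epsilon> |w|^2\<close>. The bound on \<open>D^T\<close> gives
  \<open>|w| <= c |z|\<close>, so the two terms with \<open>\<epsilon>\<close> have a nonpositive
  sum.\<close>

lemma robust_lmi_decrease:
  assumes pd: "pos_def (n + (n + T)) (three_block_mat
      (P - \<Omega>) (transpose_mat (X * Y)) (transpose_mat Y)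
      (X * Y) (P - \<epsilon> \<cdot>\<^sub>m (E * \<Delta> * transpose_mat \<Delta> * transpose_mat E)) (0\<^sub>m n T)
      Y (0\<^sub>m T n) (\<epsilon> \<cdot>\<^sub>m 1\<^sub>m T))"
    and P: "P \<in> carrier_mat n n" and \<Omega>: "\<Omega> \<in> carrier_mat n n" and X: "X \<in> carrier_mat n T"
    and Y: "Y \<in> carrier_mat T n" and E: "E \<in> carrier_mat n s" and \<Delta>: "\<Delta> = c \<cdot>\<^sub>m 1\<^sub>m s"
    and \<epsilon>: "0 \<le> \<epsilon>" and D: "D \<in> carrier_mat s T"
    and bound: "\<And>z. z \<in> carrier_vec s \<Longrightarrow> eucl_norm (transpose_mat D *\<^sub>v z) \<le> c * eucl_norm z"
    and W: "W \<in> carrier_mat n n" "P * W = 1\<^sub>m n"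
    and y: "y \<in> carrier_vec n"
  defines "a \<equiv> X *\<^sub>v (Y *\<^sub>v y) - E *\<^sub>v (D *\<^sub>v (Y *\<^sub>v y))"
  shows "a \<bullet> (W *\<^sub>v a) \<le> y \<bullet> (P *\<^sub>v y) - y \<bullet> (\<Omega> *\<^sub>v y)"
proof -
  have a: "a \<in> carrier_vec n" unfolding a_def using X Y E D y by auto
  \<comment> \<open>Test vector of the Schur complement argument; the last block absorbs the unknown term \<open>D\<close>.\<close>
  define v where "v = - (W *\<^sub>v a)"
  define z where "z = transpose_mat E *\<^sub>v v"
  define w where "w = - (transpose_mat D *\<^sub>v z)"
  have v: "v \<in> carrier_vec n" unfolding v_def using W a by auto
  have z: "z \<in> carrier_vec s" unfolding z_def using E v by auto
  have w: "w \<in> carrier_vec T" unfolding w_def using D z by auto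
  let ?R = "E * \<Delta> * transpose_mat \<Delta> * transpose_mat E"
  have R: "?R \<in> carrier_mat n n" using E by (auto simp: \<Delta>)
  then have PR: "P - \<epsilon> \<cdot>\<^sub>m ?R \<in> carrier_mat n n" by (intro minus_carrier_mat smult_carrier_mat)
  have zero_mult: "0\<^sub>m r k *\<^sub>v u = 0\<^sub>v r" if "u \<in> carrier_vec k" for r k and u :: "real vec"
    using that by (intro eq_vecI) auto
  have "0 \<le> (y @\<^sub>v v @\<^sub>v w) \<bullet> (three_block_mat
      (P - \<Omega>) (transpose_mat (X * Y)) (transpose_mat Y)
      (X * Y) (P - \<epsilon> \<cdot>\<^sub>m ?R) (0\<^sub>m n T) Y (0\<^sub>m T n) (\<epsilon> \<cdot>\<^sub>m 1\<^sub>m T) *\<^sub>v (y @\<^sub>v v @\<^sub>v w))"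
    using y v w by (intro pos_def_mult_nonneg[OF pd]) auto
  also have "\<dots> = y \<bullet> ((P - \<Omega>) *\<^sub>v y) + y \<bullet> (transpose_mat (X * Y) *\<^sub>v v) + y \<bullet> (transpose_mat Y *\<^sub>v w)
      + (v \<bullet> ((X * Y) *\<^sub>v y) + v \<bullet> ((P - \<epsilon> \<cdot>\<^sub>m ?R) *\<^sub>v v) + v \<bullet> (0\<^sub>m n T *\<^sub>v w))
      + (w \<bullet> (Y *\<^sub>v y) + w \<bullet> (0\<^sub>m T n *\<^sub>v v) + w \<bullet> ((\<epsilon> \<cdot>\<^sub>m 1\<^sub>m T) *\<^sub>v w))"
    using P \<Omega> X Y PR y v w by (intro three_block_quadratic_form) auto
  also have "y \<bullet> ((P - \<Omega>) *\<^sub>v y) = y \<bullet> (P *\<^sub>v y) - y \<bullet> (\<Omega> *\<^sub>v y)"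
    using P \<Omega> y by (simp add: minus_mult_distrib_mat_vec[of _ n n] scalar_prod_minus_distrib[of _ n])
  also have "y \<bullet> (transpose_mat (X * Y) *\<^sub>v v) = v \<bullet> (X *\<^sub>v (Y *\<^sub>v y))"
    using scalar_prod_mult_transpose[of "X * Y" n n y v] X Y y v by simp
  also have "(X * Y) *\<^sub>v y = X *\<^sub>v (Y *\<^sub>v y)"
    using X Y y by simp
  also have "y \<bullet> (transpose_mat Y *\<^sub>v w) = w \<bullet> (Y *\<^sub>v y)"
    using scalar_prod_mult_transpose[of Y T n y w] Y y w by simp
  \<comment> \<open>Here \<open>P v = - a\<close>, since \<open>W\<close> is a right inverse of
    \<open>P\<close>, so \<open>P\<close> contributes \<open>a . W a\<close>. As
    \<open>\<Delta> \<Delta>^T\<close> is \<open>c^2\<close> times the identity, the subtracted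
    matrix contributes \<open>c^2 |E^T v|^2\<close>.\<close>
  also have "v \<bullet> ((P - \<epsilon> \<cdot>\<^sub>m ?R) *\<^sub>v v) = a \<bullet> (W *\<^sub>v a) - \<epsilon> * (c * eucl_norm z)\<^sup>2"
  proof -
    have 1: "(P - \<epsilon> \<cdot>\<^sub>m ?R) *\<^sub>v v = P *\<^sub>v v - \<epsilon> \<cdot>\<^sub>v (?R *\<^sub>v v)"
      using P R v by (subst minus_mult_distrib_mat_vec[of _ n n]) (auto simp: smult_mult_mat_vec[of _ n n])
    have "transpose_mat \<Delta> = \<Delta>"
      by (auto simp: \<Delta>)
    moreover have "M * \<Delta> = c \<cdot>\<^sub>m M" if "M \<in> carrier_mat n s" for M
      using that mult_smult_distrib[OF that one_carrier_mat] by (simp add: \<Delta>)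
    ultimately have "?R = (c \<cdot>\<^sub>m (c \<cdot>\<^sub>m E)) * transpose_mat E"
      using E by simp
    also have "\<dots> = c \<cdot>\<^sub>m (c \<cdot>\<^sub>m (E * transpose_mat E))"
      using E by (simp add: mult_smult_assoc_mat[of _ n s _ n])
    finally have "?R = c \<cdot>\<^sub>m (c \<cdot>\<^sub>m (E * transpose_mat E))" .
    then have 2: "?R *\<^sub>v v = (c * c) \<cdot>\<^sub>v (E *\<^sub>v z)"
      using E v by (simp add: smult_mult_mat_vec[of _ n n] smult_smult_assoc z_def)
    have 3: "v \<bullet> (E *\<^sub>v z) = (eucl_norm z)\<^sup>2"
      using transpose_vec_mult_scalar[OF E z v] by (simp add: eucl_norm_square z_def)
    have "P *\<^sub>v (W *\<^sub>v a) = a"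
      using W P a by (simp flip: assoc_mult_mat_vec[of _ n n _ n])
    moreover have "P *\<^sub>v v = - (P *\<^sub>v (W *\<^sub>v a))"
      unfolding v_def using P W a by (intro eq_vecI) auto
    ultimately have "P *\<^sub>v v = - a" by simp
    then have 4: "v \<bullet> (P *\<^sub>v v) = a \<bullet> (W *\<^sub>v a)"
      using a W comm_scalar_prod[of "W *\<^sub>v a" n a] by (simp add: v_def)
    show ?thesis
      unfolding 1 2 using 3 4 P E v z
      by (subst scalar_prod_minus_distrib[of _ n]) (auto simp: power2_eq_square algebra_simps)
  qed
  also have "v \<bullet> (0\<^sub>m n T *\<^sub>v w) = 0"
    using v zero_mult[OF w, of n] by simp
  also have "w \<bullet> (0\<^sub>m T n *\<^sub>v v) = 0"
    using w zero_mult[OF v, of T] by simp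
  also have "w \<bullet> ((\<epsilon> \<cdot>\<^sub>m 1\<^sub>m T) *\<^sub>v w) = \<epsilon> * (w \<bullet> w)"
    using w by (simp add: smult_mult_mat_vec[of _ T T])
  finally have main: "0 \<le> y \<bullet> (P *\<^sub>v y) - y \<bullet> (\<Omega> *\<^sub>v y) + 2 * (v \<bullet> (X *\<^sub>v (Y *\<^sub>v y)) + w \<bullet> (Y *\<^sub>v y))
      + a \<bullet> (W *\<^sub>v a) + \<epsilon> * (w \<bullet> w - (c * eucl_norm z)\<^sup>2)"
    by (simp add: algebra_simps)
  have "w \<bullet> w = (eucl_norm (transpose_mat D *\<^sub>v z))\<^sup>2"
    using D z by (simp add: w_def eucl_norm_square)
  also have "\<dots> \<le> (c * eucl_norm z)\<^sup>2"
    by (intro power_mono bound z) simp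
  finally have "\<epsilon> * (w \<bullet> w - (c * eucl_norm z)\<^sup>2) \<le> 0"
    using \<epsilon> by (simp add: mult_nonneg_nonpos)
  \<comment> \<open>The choice of \<open>w\<close> gives \<open>w . Y y = - v . (E D Y y)\<close>.
    Thus the last block replaces \<open>X\<close> by the perturbed matrix \<open>X - E D\<close> in
    the cross terms, and \<open>v = - W a\<close> does the rest.\<close>
  moreover have "v \<bullet> (X *\<^sub>v (Y *\<^sub>v y)) + w \<bullet> (Y *\<^sub>v y) = - (a \<bullet> (W *\<^sub>v a))"
  proof -
    let ?f = "Y *\<^sub>v y"
    have f: "?f \<in> carrier_vec T" using Y y by auto
    have "w \<bullet> ?f = - ((transpose_mat D *\<^sub>v z) \<bullet> ?f)"
      using D Y z by (simp add: w_def)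
    also have "(transpose_mat D *\<^sub>v z) \<bullet> ?f = z \<bullet> (D *\<^sub>v ?f)"
      by (rule transpose_vec_mult_scalar[OF D f z])
    also have "\<dots> = v \<bullet> (E *\<^sub>v (D *\<^sub>v ?f))"
      unfolding z_def using D f v by (intro transpose_vec_mult_scalar[OF E]) auto
    finally have "v \<bullet> (X *\<^sub>v ?f) + w \<bullet> ?f = v \<bullet> a"
      unfolding a_def using X E D f v by (subst scalar_prod_minus_distrib[of _ n]) auto
    also have "\<dots> = - (a \<bullet> (W *\<^sub>v a))"
      using a W comm_scalar_prod[of "W *\<^sub>v a" n a] by (simp add: v_def)
    finally show ?thesis .
  qed
  moreover have "r \<le> p - q" if "0 \<le> p - q + 2 * t + r + k" "k \<le> 0" "t = - r" for p q r t k :: real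
    using that by linarith
  ultimately show ?thesis using main by blast
qed

section \<open>Bounds on the terms that contain unknown samples or the current disturbance\<close>

lemma induced_norm_nonneg:
  assumes "M \<in> carrier_mat r k"
  shows "0 \<le> induced_norm M"
proof (cases "k = 0")
  case True
  \<comment> \<open>Without columns there is no unit vector to test with, and the supremum runs over
    the single empty vector.\<close>
  then have "{v \<in> carrier_vec (dim_col M). eucl_norm v \<le> 1} = {0\<^sub>v 0}"
    using assms by (auto simp: eucl_norm_def)
  then show ?thesis by (simp add: induced_norm_def)
next
  case False
  let ?u = "unit_vec k 0 :: real vec"
  have "eucl_norm ?u = 1" using False by (simp add: eucl_norm_def)
  then have "eucl_norm (M *\<^sub>v ?u) \<le> induced_norm M"
    using eucl_norm_mult_mat_vec_le[OF assms, of ?u] by simp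
  then show ?thesis using eucl_norm_nonneg order_trans by blast
qed

lemma abs_bilinear_le_induced_norm:
  assumes "M \<in> carrier_mat r k" "u \<in> carrier_vec r" "v \<in> carrier_vec k"
  shows "\<bar>u \<bullet> (M *\<^sub>v v)\<bar> \<le> induced_norm M * eucl_norm u * eucl_norm v"
proof -
  have "\<bar>u \<bullet> (M *\<^sub>v v)\<bar> \<le> eucl_norm u * eucl_norm (M *\<^sub>v v)"
    using assms by (intro abs_scalar_prod_le[of _ r]) auto
  also have "\<dots> \<le> eucl_norm u * (induced_norm M * eucl_norm v)"
    using assms by (intro mult_left_mono eucl_norm_mult_mat_vec_le) auto
  finally show ?thesis by (simp add: mult_ac)
qed

text \<open>This collects the known matrices between two unknown vectors into
  \<open>E^T W E\<close>, whose induced norm occurs in \<open>ell4\<close>, \<open>r2\<close> and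
  \<open>r3\<close>.\<close>

lemma mult_vec_scalar_prod_mult_vec:
  fixes E W :: "real mat"
  assumes E: "E \<in> carrier_mat n s" and W: "W \<in> carrier_mat n n"
    and v: "y \<in> carrier_vec s" "z \<in> carrier_vec s"
  shows "(E *\<^sub>v y) \<bullet> (W *\<^sub>v (E *\<^sub>v z)) = y \<bullet> ((transpose_mat E * W * E) *\<^sub>v z)"
proof -
  have EW: "transpose_mat E * W \<in> carrier_mat s n" using E W by auto
  have "(transpose_mat E * W * E) *\<^sub>v z = transpose_mat E *\<^sub>v (W *\<^sub>v (E *\<^sub>v z))"
    using E W v unfolding assoc_mult_mat_vec[OF EW E v(2)] by (intro assoc_mult_mat_vec) auto
  then show ?thesis
    using scalar_prod_mult_transpose[OF E v(1), of "W *\<^sub>v (E *\<^sub>v z)"]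
      comm_scalar_prod[of "E *\<^sub>v y" n "W *\<^sub>v (E *\<^sub>v z)"] E W v by simp
qed

text \<open>Expanding the two differences gives four terms; every occurrence of the unknown
  \<open>D\<close> is removed by Cauchy-Schwarz and the bound \<open>N\<close>. With
  \<open>h = 2 G1 x + G2 Q(x)\<close>, \<open>f = G2 Q(x)\<close> and \<open>N\<close> the norm of
  \<open>\<Delta>\<close>, the four summands on the right are \<open>ell1\<close> to
  \<open>ell4\<close>.\<close>

lemma perturbed_bilinear_le:
  assumes X: "X \<in> carrier_mat n T" and E: "E \<in> carrier_mat n s" and D: "D \<in> carrier_mat s T"
    and W: "W \<in> carrier_mat n n" and N: "0 \<le> N"
    and bound: "\<And>f. f \<in> carrier_vec T \<Longrightarrow> eucl_norm (D *\<^sub>v f) \<le> N * eucl_norm f"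
    and h: "h \<in> carrier_vec T" and f: "f \<in> carrier_vec T"
  shows "(X *\<^sub>v h - E *\<^sub>v (D *\<^sub>v h)) \<bullet> (W *\<^sub>v (X *\<^sub>v f - E *\<^sub>v (D *\<^sub>v f))) \<le>
    (X *\<^sub>v h) \<bullet> (W *\<^sub>v (X *\<^sub>v f))
    + N * eucl_norm (transpose_mat (W * E) *\<^sub>v (X *\<^sub>v h)) * eucl_norm f
    + N * eucl_norm h * eucl_norm (transpose_mat E *\<^sub>v (W *\<^sub>v (X *\<^sub>v f)))
    + N\<^sup>2 * induced_norm (transpose_mat E * W * E) * eucl_norm h * eucl_norm f"
proof -
  let ?p = "X *\<^sub>v h" and ?q = "X *\<^sub>v f" and ?zh = "D *\<^sub>v h" and ?zf = "D *\<^sub>v f"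
  let ?M = "transpose_mat E * W * E"
  have M: "?M \<in> carrier_mat s s" using E W by auto
  have c: "?p \<in> carrier_vec n" "?q \<in> carrier_vec n" "?zh \<in> carrier_vec s" "?zf \<in> carrier_vec s"
    using X D h f by auto
  have Ez: "(E *\<^sub>v ?zh) \<bullet> u = ?zh \<bullet> (transpose_mat E *\<^sub>v u)" if "u \<in> carrier_vec n" for u
    using scalar_prod_mult_transpose[OF E c(3) that] comm_scalar_prod[of "E *\<^sub>v ?zh" n u] E c that by simp
  have "(?p - E *\<^sub>v ?zh) \<bullet> (W *\<^sub>v (?q - E *\<^sub>v ?zf)) = ?p \<bullet> (W *\<^sub>v ?q) - ?p \<bullet> (W *\<^sub>v (E *\<^sub>v ?zf))
      - ((E *\<^sub>v ?zh) \<bullet> (W *\<^sub>v ?q) - (E *\<^sub>v ?zh) \<bullet> (W *\<^sub>v (E *\<^sub>v ?zf)))"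
    using W E c by (simp add: mult_minus_distrib_mat_vec[of _ n n] minus_scalar_prod_distrib[of _ n]
        scalar_prod_minus_distrib[of _ n])
  also have "?p \<bullet> (W *\<^sub>v (E *\<^sub>v ?zf)) = (transpose_mat (W * E) *\<^sub>v ?p) \<bullet> ?zf"
    using transpose_vec_mult_scalar[of "W * E" n s ?zf ?p] W E c by simp
  also have "(E *\<^sub>v ?zh) \<bullet> (W *\<^sub>v ?q) = ?zh \<bullet> (transpose_mat E *\<^sub>v (W *\<^sub>v ?q))"
    using W c by (intro Ez) auto
  also have "(E *\<^sub>v ?zh) \<bullet> (W *\<^sub>v (E *\<^sub>v ?zf)) = ?zh \<bullet> (?M *\<^sub>v ?zf)"
    by (rule mult_vec_scalar_prod_mult_vec[OF E W c(3,4)])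
  finally have eq: "(?p - E *\<^sub>v ?zh) \<bullet> (W *\<^sub>v (?q - E *\<^sub>v ?zf)) = ?p \<bullet> (W *\<^sub>v ?q)
      - (transpose_mat (W * E) *\<^sub>v ?p) \<bullet> ?zf - ?zh \<bullet> (transpose_mat E *\<^sub>v (W *\<^sub>v ?q)) + ?zh \<bullet> (?M *\<^sub>v ?zf)"
    by simp
  have "\<bar>(transpose_mat (W * E) *\<^sub>v ?p) \<bullet> ?zf\<bar> \<le> eucl_norm (transpose_mat (W * E) *\<^sub>v ?p) * eucl_norm ?zf"
    using W E c by (intro abs_scalar_prod_le[OF mult_mat_vec_carrier[of _ s n]]) auto
  also have "\<dots> \<le> eucl_norm (transpose_mat (W * E) *\<^sub>v ?p) * (N * eucl_norm f)"
    by (intro mult_left_mono bound f) simp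
  finally have 1: "- ((transpose_mat (W * E) *\<^sub>v ?p) \<bullet> ?zf) \<le>
      N * eucl_norm (transpose_mat (W * E) *\<^sub>v ?p) * eucl_norm f"
    by (simp add: mult_ac abs_le_iff)
  have "\<bar>?zh \<bullet> (transpose_mat E *\<^sub>v (W *\<^sub>v ?q))\<bar> \<le>
      eucl_norm ?zh * eucl_norm (transpose_mat E *\<^sub>v (W *\<^sub>v ?q))"
    using W E c by (intro abs_scalar_prod_le[of _ s]) auto
  also have "\<dots> \<le> (N * eucl_norm h) * eucl_norm (transpose_mat E *\<^sub>v (W *\<^sub>v ?q))"
    by (intro mult_right_mono bound h) simp
  finally have 2: "- (?zh \<bullet> (transpose_mat E *\<^sub>v (W *\<^sub>v ?q))) \<le>
      N * eucl_norm h * eucl_norm (transpose_mat E *\<^sub>v (W *\<^sub>v ?q))"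
    by (simp add: abs_le_iff)
  have "?zh \<bullet> (?M *\<^sub>v ?zf) \<le> induced_norm ?M * eucl_norm ?zh * eucl_norm ?zf"
    using abs_bilinear_le_induced_norm[OF M c(3,4)] by simp
  also have "\<dots> = induced_norm ?M * (eucl_norm ?zh * eucl_norm ?zf)"
    by simp
  also have "\<dots> \<le> induced_norm ?M * ((N * eucl_norm h) * (N * eucl_norm f))"
    using N by (intro mult_left_mono mult_mono bound h f induced_norm_nonneg[OF M]) auto
  finally have 3: "?zh \<bullet> (?M *\<^sub>v ?zf) \<le> N\<^sup>2 * induced_norm ?M * eucl_norm h * eucl_norm f"
    by (simp add: power2_eq_square mult_ac)
  show ?thesis
    unfolding eq using 1 2 3 by linarith
qed

text \<open>The same estimate for the cross term with the current disturbance \<open>e\<close>. With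
  \<open>h = G1 x + G2 Q(x)\<close>, twice the right-hand side is the part of \<open>g_bound\<close>
  linear in \<open>\<delta>\<close>.\<close>

lemma perturbed_disturbance_le:
  assumes X: "X \<in> carrier_mat n T" and E: "E \<in> carrier_mat n s" and D: "D \<in> carrier_mat s T"
    and W: "W \<in> carrier_mat n n" and N: "0 \<le> N"
    and bound: "\<And>f. f \<in> carrier_vec T \<Longrightarrow> eucl_norm (D *\<^sub>v f) \<le> N * eucl_norm f"
    and h: "h \<in> carrier_vec T" and e: "e \<in> carrier_vec s" "eucl_norm e \<le> \<delta>"
  shows "(X *\<^sub>v h - E *\<^sub>v (D *\<^sub>v h)) \<bullet> (W *\<^sub>v (E *\<^sub>v e)) \<le>
    eucl_norm (transpose_mat (W * E) *\<^sub>v (X *\<^sub>v h)) * \<delta>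
    + N * induced_norm (transpose_mat E * W * E) * eucl_norm h * \<delta>"
proof -
  let ?p = "X *\<^sub>v h" and ?z = "D *\<^sub>v h" and ?M = "transpose_mat E * W * E"
  have M: "?M \<in> carrier_mat s s" using E W by auto
  have c: "?p \<in> carrier_vec n" "?z \<in> carrier_vec s" using X D h by auto
  have "(?p - E *\<^sub>v ?z) \<bullet> (W *\<^sub>v (E *\<^sub>v e)) = ?p \<bullet> ((W * E) *\<^sub>v e) - (E *\<^sub>v ?z) \<bullet> (W *\<^sub>v (E *\<^sub>v e))"
    using W E c e by (simp add: minus_scalar_prod_distrib[of _ n])
  also have "?p \<bullet> ((W * E) *\<^sub>v e) = (transpose_mat (W * E) *\<^sub>v ?p) \<bullet> e"
    using transpose_vec_mult_scalar[of "W * E" n s e ?p] W E c e by simp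
  also have "(E *\<^sub>v ?z) \<bullet> (W *\<^sub>v (E *\<^sub>v e)) = ?z \<bullet> (?M *\<^sub>v e)"
    using mult_vec_scalar_prod_mult_vec[OF E W c(2) e(1)] .
  finally have eq: "(?p - E *\<^sub>v ?z) \<bullet> (W *\<^sub>v (E *\<^sub>v e)) =
    (transpose_mat (W * E) *\<^sub>v ?p) \<bullet> e - ?z \<bullet> (?M *\<^sub>v e)" .
  have "\<bar>(transpose_mat (W * E) *\<^sub>v ?p) \<bullet> e\<bar> \<le> eucl_norm (transpose_mat (W * E) *\<^sub>v ?p) * eucl_norm e"
    using W E c e by (intro abs_scalar_prod_le[OF mult_mat_vec_carrier[of _ s n]]) auto
  also have "\<dots> \<le> eucl_norm (transpose_mat (W * E) *\<^sub>v ?p) * \<delta>"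
    by (intro mult_left_mono e) simp
  finally have 1: "(transpose_mat (W * E) *\<^sub>v ?p) \<bullet> e \<le> eucl_norm (transpose_mat (W * E) *\<^sub>v ?p) * \<delta>"
    by simp
  have "- (?z \<bullet> (?M *\<^sub>v e)) \<le> induced_norm ?M * eucl_norm ?z * eucl_norm e"
    using abs_bilinear_le_induced_norm[OF M c(2) e(1)] by simp
  also have "\<dots> = induced_norm ?M * (eucl_norm ?z * eucl_norm e)"
    by simp
  also have "\<dots> \<le> induced_norm ?M * ((N * eucl_norm h) * \<delta>)"
    using N by (intro mult_left_mono mult_mono bound h e induced_norm_nonneg[OF M]) auto
  finally have 2: "- (?z \<bullet> (?M *\<^sub>v e)) \<le> N * induced_norm ?M * eucl_norm h * \<delta>"
    by (simp add: mult_ac)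
  show ?thesis
    unfolding eq using 1 2 by linarith
qed

section \<open>The closed loop in terms of the data, and invariance of the sublevel set\<close>

theorem theorem8:
  fixes n m s S T :: nat
    and A B E :: "real mat"
    and Q d :: "real vec \<Rightarrow> real vec"
    and Qset :: "real vec set"
    and x u :: "nat \<Rightarrow> real vec"
    and \<delta> \<epsilon> \<gamma> :: real
    and U0 X1 Z0 \<Delta> \<Omega> P1 Y1 G1 G2 K :: "real mat"
    and \<X> \<Z> :: "real vec set"
  assumes dims: "0 < n" "0 < m" "0 < s" "0 < S" "0 < T" "n \<le> S"
    and system: "A \<in> carrier_mat n S" "B \<in> carrier_mat n m" "E \<in> carrier_mat n s"
      "Q \<in> carrier_vec n \<rightarrow> carrier_vec (S - n)" "d \<in> carrier_vec n \<rightarrow> carrier_vec s"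
    and Q_limit: "((\<lambda>v. eucl_norm (Q v) / eucl_norm v) \<longlongrightarrow> 0)
      (inf (filtercomap eucl_norm (at_right 0)) (principal (carrier_vec n)))"
    and d_bound: "Qset \<subseteq> carrier_vec n" "0 < \<delta>" "\<And>v. v \<in> Qset \<Longrightarrow> eucl_norm (d v) \<le> \<delta>"
    and samples: "\<And>k. k \<le> T \<Longrightarrow> x k \<in> carrier_vec n"
      "\<And>k. k < T \<Longrightarrow> u k \<in> carrier_vec m"
      "\<And>k. k < T \<Longrightarrow> x (k + 1) = A *\<^sub>v lift_state Q (x k) + B *\<^sub>v u k + E *\<^sub>v d (x k)"
      "\<And>k. k < T \<Longrightarrow> x k \<in> Qset"
    and data: "U0 = mat_of_cols m (map u [0..<T])"
      "X1 = mat_of_cols n (map x [1..<T + 1])"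
      "Z0 = mat_of_cols S (map (\<lambda>k. lift_state Q (x k)) [0..<T])"
    and Omega: "pos_def n \<Omega>"
    and Delta: "\<Delta> = (\<delta> * sqrt (real T)) \<cdot>\<^sub>m 1\<^sub>m s"
    and feasible: "feasible_point n S T X1 Z0 E \<Delta> \<Omega> P1 Y1 G2 \<epsilon>"
    and gain: "G1 = Y1 * minv P1" "K = U0 * append_cols G1 G2"
    and gamma: "0 < \<gamma>"
    and X_set: "\<X> = {v \<in> carrier_vec n. ell Q X1 E \<Delta> \<Omega> P1 G1 G2 v + g_bound Q X1 E \<Delta> P1 G1 G2 v \<delta> \<le> 0}"
    and Z_set: "\<Z> = sublevel n P1 \<gamma> \<inter> (carrier_vec n - \<X>)"
    and sublevel_subset: "sublevel n P1 \<gamma> \<subseteq> Qset"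
    and decrease: "\<And>v. v \<in> \<Z> \<Longrightarrow>
      lyap P1 v + ell Q X1 E \<Delta> \<Omega> P1 G1 G2 v + g_bound Q X1 E \<Delta> P1 G1 G2 v \<delta> \<le> \<gamma>"
  shows "positively_invariant
    (\<lambda>v. A *\<^sub>v lift_state Q v + B * K *\<^sub>v lift_state Q v + E *\<^sub>v d v) (sublevel n P1 \<gamma>)"
proof -
  have P1sym: "sym_mat n P1" and P1: "P1 \<in> carrier_mat n n" and Y1: "Y1 \<in> carrier_mat T n"
    and G2: "G2 \<in> carrier_mat T (S - n)" and \<epsilon>: "0 < \<epsilon>"
    and ZY: "Z0 * Y1 = (P1 @\<^sub>r 0\<^sub>m (S - n) n)"
    and ZG: "Z0 * G2 = (0\<^sub>m n (S - n) @\<^sub>r 1\<^sub>m (S - n))"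
    and lmi: "pos_def (n + (n + T)) (three_block_mat
      (P1 - \<Omega>) (transpose_mat (X1 * Y1)) (transpose_mat Y1)
      (X1 * Y1) (P1 - \<epsilon> \<cdot>\<^sub>m (E * \<Delta> * transpose_mat \<Delta> * transpose_mat E)) (0\<^sub>m n T)
      Y1 (0\<^sub>m T n) (\<epsilon> \<cdot>\<^sub>m 1\<^sub>m T))"
    using feasible by (auto simp: feasible_point_def sym_mat_def)
  have \<Omega>: "\<Omega> \<in> carrier_mat n n"
    using Omega by (simp add: pos_def_def sym_mat_def)
  have A: "A \<in> carrier_mat n S" and B: "B \<in> carrier_mat n m" and E: "E \<in> carrier_mat n s"
    and Q: "\<And>v. v \<in> carrier_vec n \<Longrightarrow> Q v \<in> carrier_vec (S - n)"
    and d: "\<And>v. v \<in> carrier_vec n \<Longrightarrow> d v \<in> carrier_vec s"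
    using system by auto
  have lift: "lift_state Q v \<in> carrier_vec S" if "v \<in> carrier_vec n" for v
    using append_carrier_vec[OF that Q[OF that]] dims by (simp add: lift_state_def)
  have cols_carrier: "mat_of_cols k (map f [i..<j]) \<in> carrier_mat k (j - i)"
    for k i j and f :: "nat \<Rightarrow> real vec"
    using mat_of_cols_carrier(1)[of k "map f [i..<j]"] by simp
  have U0: "U0 \<in> carrier_mat m T" and X1: "X1 \<in> carrier_mat n T" and Z0: "Z0 \<in> carrier_mat S T"
    unfolding data using cols_carrier[of m u 0 T] cols_carrier[of n x 1 "T + 1"]
      cols_carrier[of S "\<lambda>k. lift_state Q (x k)" 0 T]
    by (simp_all only: minus_nat.diff_0 add_diff_cancel_right')
  define ds where "ds = map (\<lambda>k. d (x k)) [0..<T]"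
  define D0 where "D0 = mat_of_cols s ds"
  have len: "length ds = T" by (simp add: ds_def)
  have D0: "D0 \<in> carrier_mat s T"
    unfolding D0_def using mat_of_cols_carrier(1)[of s ds] by (simp add: len)
  have X1_eq: "X1 = A * Z0 + B * U0 + E * D0"
  proof (rule eq_matI)
    fix i j assume "i < dim_row (A * Z0 + B * U0 + E * D0)" "j < dim_col (A * Z0 + B * U0 + E * D0)"
    then have ij: "i < n" "j < T" using E D0 by auto
    \<comment> \<open>The columns of \<open>X1\<close> start at sample 1, so column \<open>j\<close>
      is the successor of the state in column \<open>j\<close> of \<open>Z0\<close>.\<close>
    have "mat_of_cols n (map x [k..<l]) $$ (i, j) = x (k + j) $ i" if "j < l - k" for k l
      using that ij by (simp add: mat_of_cols_index)
    from this[of "T + 1" 1] have "X1 $$ (i, j) = x (j + 1) $ i"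
      using ij by (simp only: data add_diff_cancel_right' add.commute)
    also have "x (j + 1) = A *\<^sub>v lift_state Q (x j) + B *\<^sub>v u j + E *\<^sub>v d (x j)"
      by (rule samples(3)[OF ij(2)])
    also have "lift_state Q (x j) = col Z0 j"
      using ij lift samples(1) by (simp add: data)
    also have "u j = col U0 j"
      using ij samples(2) by (simp add: data)
    also have "d (x j) = col D0 j"
      using ij d samples(1) by (simp add: D0_def ds_def)
    finally show "X1 $$ (i, j) = (A * Z0 + B * U0 + E * D0) $$ (i, j)"
      using ij A B E Z0 U0 D0 by simp
  qed (use X1 E D0 in auto)
  define c where "c = \<delta> * sqrt (real T)"
  have c0: "0 \<le> c" using d_bound(2) by (simp add: c_def)
  have \<Delta>: "\<Delta> = c \<cdot>\<^sub>m 1\<^sub>m s" and \<Delta>c: "\<Delta> \<in> carrier_mat s s" using Delta by (simp_all add: c_def)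
  have D0T: "eucl_norm (transpose_mat D0 *\<^sub>v z) \<le> c * eucl_norm z" if "z \<in> carrier_vec s" for z
  proof -
    have "set ds \<subseteq> carrier_vec s"
      using d samples(1) by (auto simp: ds_def)
    moreover have "eucl_norm w \<le> \<delta>" if "w \<in> set ds" for w
      using that d_bound(3) samples(4) by (auto simp: ds_def)
    ultimately show ?thesis
      using eucl_norm_transpose_mat_of_cols_le[of ds s \<delta> z] d_bound(2) that
      by (simp add: D0_def c_def len)
  qed
  define N where "N = induced_norm \<Delta>"
  have N: "0 \<le> N" unfolding N_def by (rule induced_norm_nonneg[OF \<Delta>c])
  \<comment> \<open>The samples give a bound with constant \<open>c\<close>, whereas
    \<open>ell\<close> and \<open>g_bound\<close> use the induced norm of \<open>\<Delta>\<close>.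
    Applying \<open>\<Delta>\<close> to a unit vector, which exists as \<open>s\<close> is positive,
    compares the two.\<close>
  have cN: "c \<le> N"
    using eucl_norm_mult_mat_vec_le[OF \<Delta>c, of "unit_vec s 0"] dims c0
    by (simp add: \<Delta> N_def smult_mult_mat_vec[of _ s s] eucl_norm_smult)
      (simp add: eucl_norm_def)
  have D0N: "eucl_norm (D0 *\<^sub>v f) \<le> N * eucl_norm f" if "f \<in> carrier_vec T" for f
    using eucl_norm_transpose_bound[OF D0 c0 D0T that]
      mult_right_mono[OF cN eucl_norm_nonneg[of f]] by linarith
  \<comment> \<open>Feasibility only states that \<open>P1\<close> is symmetric; definiteness comes
    from the middle diagonal block and makes \<open>minv P1\<close> a true inverse.\<close>
  have P1pd: "pos_def n P1"
    by (rule three_block_pos_def_imp_pos_def[OF lmi _ _ _ _ _ _ _ _ P1sym E \<Delta>c])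
      (use P1 \<Omega> X1 Y1 \<epsilon> in auto)
  define W where "W = minv P1"
  note W = pos_def_imp_minv[OF P1pd, folded W_def]
  have G1: "G1 \<in> carrier_mat T n" using Y1 W by (simp add: gain W_def[symmetric])
  let ?F = "\<lambda>v. A *\<^sub>v lift_state Q v + B * K *\<^sub>v lift_state Q v + E *\<^sub>v d v"
  \<comment> \<open>The unknown \<open>A\<close> and \<open>B\<close> are eliminated:
    \<open>X1 - E D0 = A Z0 + B U0\<close>, and the equality constraints make
    \<open>Z0 (G1 v + G2 Q(v))\<close> equal to the regressor at \<open>v\<close>.\<close>
  have F_eq: "?F v = (X1 *\<^sub>v (G1 *\<^sub>v v) - E *\<^sub>v (D0 *\<^sub>v (G1 *\<^sub>v v))) +
      (X1 *\<^sub>v (G2 *\<^sub>v Q v) - E *\<^sub>v (D0 *\<^sub>v (G2 *\<^sub>v Q v))) + E *\<^sub>v d v"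
    if v: "v \<in> carrier_vec n" for v
  proof -
    let ?f = "G1 *\<^sub>v v" and ?g = "G2 *\<^sub>v Q v"
    have f: "?f \<in> carrier_vec T" and g: "?g \<in> carrier_vec T" using G1 G2 v Q by auto
    have X1_mult: "X1 *\<^sub>v h - E *\<^sub>v (D0 *\<^sub>v h) = A *\<^sub>v (Z0 *\<^sub>v h) + B *\<^sub>v (U0 *\<^sub>v h)"
      if h: "h \<in> carrier_vec T" for h
    proof -
      have "X1 *\<^sub>v h = A *\<^sub>v (Z0 *\<^sub>v h) + B *\<^sub>v (U0 *\<^sub>v h) + E *\<^sub>v (D0 *\<^sub>v h)"
        unfolding X1_eq using A B E Z0 U0 D0 h by (simp add: add_mult_distrib_mat_vec[of _ n T])
      then show ?thesis
        using A B E Z0 U0 D0 h by (intro eq_vecI) auto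
    qed
    have "Z0 *\<^sub>v ?f = (P1 @\<^sub>r 0\<^sub>m (S - n) n) *\<^sub>v (W *\<^sub>v v)"
      using Z0 Y1 W v by (simp add: gain W_def[symmetric] ZY[symmetric])
    also have "\<dots> = v @\<^sub>v 0\<^sub>v (S - n)"
      using P1 W v by (subst mat_mult_append[of _ n n]) (auto simp: assoc_mult_mat_vec[symmetric])
    finally have Zf: "Z0 *\<^sub>v ?f = v @\<^sub>v 0\<^sub>v (S - n)" .
    have "Z0 *\<^sub>v ?g = (0\<^sub>m n (S - n) @\<^sub>r 1\<^sub>m (S - n)) *\<^sub>v Q v"
      using Z0 G2 Q[OF v] by (simp add: ZG[symmetric])
    also have "\<dots> = 0\<^sub>v n @\<^sub>v Q v"
      using Q[OF v] by (subst mat_mult_append) auto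
    finally have Zg: "Z0 *\<^sub>v ?g = 0\<^sub>v n @\<^sub>v Q v" .
    have "Z0 *\<^sub>v ?f + Z0 *\<^sub>v ?g = lift_state Q v"
      unfolding Zf Zg lift_state_def using v Q[OF v]
      by (subst append_vec_add[of _ n _ _ "S - n"]) auto
    then have Z: "Z0 *\<^sub>v (?f + ?g) = lift_state Q v"
      using mult_add_distrib_mat_vec[OF Z0 f g] by simp
    have G: "append_cols G1 G2 \<in> carrier_mat T S"
      using append_cols_carrier[OF G1 G2] dims by simp
    then have K: "K \<in> carrier_mat m S"
      using U0 by (simp add: gain(2))
    have "B * K *\<^sub>v lift_state Q v = B *\<^sub>v (U0 *\<^sub>v (append_cols G1 G2 *\<^sub>v lift_state Q v))"
      using assoc_mult_mat_vec[OF B K lift[OF v]]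
      by (simp only: gain(2) assoc_mult_mat_vec[OF U0 G lift[OF v]])
    also have "append_cols G1 G2 *\<^sub>v lift_state Q v = ?f + ?g"
      unfolding lift_state_def by (rule append_cols_mult_vec[OF G1 G2 v Q[OF v]])
    finally have "?F v = (X1 *\<^sub>v (?f + ?g) - E *\<^sub>v (D0 *\<^sub>v (?f + ?g))) + E *\<^sub>v d v"
      using X1_mult[of "?f + ?g"] f g by (simp add: Z)
    then show ?thesis
      using X1 E D0 f g d[OF v]
      by (simp add: mult_add_distrib_mat_vec[of _ n T] mult_add_distrib_mat_vec[of _ s T]
          mult_add_distrib_mat_vec[of _ n s]) (auto intro!: eq_vecI)
  qed
  have lyap_F: "lyap P1 (?F v) \<le> lyap P1 v + ell Q X1 E \<Delta> \<Omega> P1 G1 G2 v + g_bound Q X1 E \<Delta> P1 G1 G2 v \<delta>"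
    if v: "v \<in> carrier_vec n" and dv: "eucl_norm (d v) \<le> \<delta>" for v
  proof -
    let ?f = "G1 *\<^sub>v v" and ?g = "G2 *\<^sub>v Q v"
    let ?M = "transpose_mat E * W * E"
    define a where "a = X1 *\<^sub>v ?f - E *\<^sub>v (D0 *\<^sub>v ?f)"
    define b where "b = X1 *\<^sub>v ?g - E *\<^sub>v (D0 *\<^sub>v ?g)"
    define e where "e = E *\<^sub>v d v"
    define h where "h = 2 \<cdot>\<^sub>v ?f + ?g"
    have f: "?f \<in> carrier_vec T" and g: "?g \<in> carrier_vec T" using G1 G2 v Q by auto
    have h: "h \<in> carrier_vec T" using f g by (simp add: h_def)
    have abe: "a \<in> carrier_vec n" "b \<in> carrier_vec n" "e \<in> carrier_vec n"
      using X1 E D0 f g d[OF v] by (auto simp: a_def b_def e_def)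
    have M: "?M \<in> carrier_mat s s" using E W by auto
    have p: "2 \<cdot>\<^sub>v (X1 * G1 *\<^sub>v v) + X1 * G2 *\<^sub>v Q v = X1 *\<^sub>v h"
      using X1 G1 G2 v Q[OF v] f g
      by (simp add: h_def mult_add_distrib_mat_vec[of _ n T] mult_mat_vec[of _ n T])
    have p': "X1 * G1 *\<^sub>v v + X1 * G2 *\<^sub>v Q v = X1 *\<^sub>v (?f + ?g)"
      using X1 G1 G2 v Q[OF v] f g by (simp add: mult_add_distrib_mat_vec[of _ n T])
    have Xg: "X1 * G2 *\<^sub>v Q v = X1 *\<^sub>v ?g"
      using X1 G2 Q[OF v] by simp
    have "lyap P1 (?F v) = (a + b + e) \<bullet> (W *\<^sub>v (a + b + e))"
      unfolding F_eq[OF v] lyap_def a_def b_def e_def W_def ..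
    also have "\<dots> = a \<bullet> (W *\<^sub>v a) + (2 \<cdot>\<^sub>v a + b) \<bullet> (W *\<^sub>v b) + 2 * ((a + b) \<bullet> (W *\<^sub>v e)) + e \<bullet> (W *\<^sub>v e)"
      by (rule quadratic_form_add3[OF W(1,4) abe])
    finally have expand: "lyap P1 (?F v) = \<dots>" .
    \<comment> \<open>The decrease lemma is used at \<open>y = W v\<close>, since
      \<open>Y1 W = G1\<close>; its term in \<open>\<Omega>\<close> then becomes the form of
      \<open>W \<Omega> W\<close> at \<open>v\<close>.\<close>
    have 1: "a \<bullet> (W *\<^sub>v a) \<le> lyap P1 v - v \<bullet> (W * \<Omega> * W *\<^sub>v v)"
    proof -
      let ?y = "W *\<^sub>v v"
      have y: "?y \<in> carrier_vec n" using W v by auto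
      have fy: "Y1 *\<^sub>v ?y = ?f" using Y1 W v by (simp add: gain W_def[symmetric])
      have "a \<bullet> (W *\<^sub>v a) \<le> ?y \<bullet> (P1 *\<^sub>v ?y) - ?y \<bullet> (\<Omega> *\<^sub>v ?y)"
        using robust_lmi_decrease[OF lmi P1 \<Omega> X1 Y1 E \<Delta> _ D0 D0T W(1,2) y] \<epsilon>
        by (simp add: a_def fy)
      also have "P1 *\<^sub>v ?y = v"
        using assoc_mult_mat_vec[OF P1 W(1) v] W(2) v by simp
      also have "?y \<bullet> v = lyap P1 v"
        unfolding lyap_def W_def[symmetric] by (rule comm_scalar_prod[OF y v])
      also have "?y \<bullet> (\<Omega> *\<^sub>v ?y) = v \<bullet> (W *\<^sub>v (\<Omega> *\<^sub>v ?y))"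
        using transpose_vec_mult_scalar[OF W(1) _ v, of "\<Omega> *\<^sub>v ?y"] \<Omega> y by (simp add: W(4))
      also have "W *\<^sub>v (\<Omega> *\<^sub>v ?y) = W * \<Omega> * W *\<^sub>v v"
        using assoc_mult_mat_vec[OF mult_carrier_mat[OF W(1) \<Omega>] W(1) v]
          assoc_mult_mat_vec[OF W(1) \<Omega> y] by simp
      finally show ?thesis .
    qed
    \<comment> \<open>Both \<open>a\<close> and \<open>b\<close> are images under the same linear
      map \<open>X1 - E D0\<close>, so the combination is the image of \<open>h\<close>.\<close>
    have ab: "2 \<cdot>\<^sub>v a + b = X1 *\<^sub>v h - E *\<^sub>v (D0 *\<^sub>v h)"
      unfolding a_def b_def h_def using X1 E D0 f g
      by (simp add: mult_add_distrib_mat_vec[of _ n T] mult_add_distrib_mat_vec[of _ s T]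
          mult_add_distrib_mat_vec[of _ n s] mult_mat_vec[of _ n T] mult_mat_vec[of _ s T]
          mult_mat_vec[of _ n s]) (auto intro!: eq_vecI simp: algebra_simps)
    have "transpose_mat E * W * X1 * G2 *\<^sub>v Q v = transpose_mat E *\<^sub>v (W *\<^sub>v (X1 *\<^sub>v ?g))"
    proof -
      have c: "transpose_mat E * W \<in> carrier_mat s n" "transpose_mat E * W * X1 \<in> carrier_mat s T"
        using E W X1 by auto
      show ?thesis
        unfolding assoc_mult_mat_vec[OF c(2) G2 Q[OF v]] assoc_mult_mat_vec[OF c(1) X1 g]
        using E W X1 g by (intro assoc_mult_mat_vec) auto
    qed
    then have 2: "(2 \<cdot>\<^sub>v a + b) \<bullet> (W *\<^sub>v b) \<le> ell1 X1 P1 G1 G2 v (Q v) + ell2 X1 E \<Delta> P1 G1 G2 v (Q v)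
        + ell3 X1 E \<Delta> P1 G1 G2 v (Q v) + ell4 E \<Delta> P1 G1 G2 v (Q v)"
      using perturbed_bilinear_le[OF X1 E D0 W(1) N D0N h g]
      unfolding ell1_def ell2_def ell3_def ell4_def p W_def[symmetric] N_def[symmetric] ab
      unfolding b_def Xg h_def[symmetric] by simp
    have ab': "a + b = X1 *\<^sub>v (?f + ?g) - E *\<^sub>v (D0 *\<^sub>v (?f + ?g))"
      unfolding a_def b_def using X1 E D0 f g
      by (simp add: mult_add_distrib_mat_vec[of _ n T] mult_add_distrib_mat_vec[of _ s T]
          mult_add_distrib_mat_vec[of _ n s]) (auto intro!: eq_vecI)
    have 3: "2 * ((a + b) \<bullet> (W *\<^sub>v e)) \<le> r1 X1 E P1 G1 G2 v (Q v) * \<delta> + r2 E \<Delta> P1 G1 G2 v (Q v) * \<delta>"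
      using perturbed_disturbance_le[OF X1 E D0 W(1) N D0N add_carrier_vec[OF f g] d[OF v] dv]
      unfolding ab' e_def r1_def r2_def p' W_def[symmetric] N_def[symmetric] by simp
    have 4: "e \<bullet> (W *\<^sub>v e) \<le> r3 E P1 * \<delta>\<^sup>2"
    proof -
      have "e \<bullet> (W *\<^sub>v e) = d v \<bullet> (?M *\<^sub>v d v)"
        unfolding e_def by (rule mult_vec_scalar_prod_mult_vec[OF E W(1) d[OF v] d[OF v]])
      also have "\<dots> \<le> induced_norm ?M * (eucl_norm (d v))\<^sup>2"
        using abs_bilinear_le_induced_norm[OF M d[OF v] d[OF v]] by (simp add: power2_eq_square)
      also have "\<dots> \<le> induced_norm ?M * \<delta>\<^sup>2"
        by (intro mult_left_mono power_mono dv induced_norm_nonneg[OF M]) simp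
      finally show ?thesis by (simp add: r3_def W_def)
    qed
    show ?thesis
      unfolding expand ell_def g_bound_def W_def[symmetric] using 1 2 3 4 by linarith
  qed
  have step: "?F v \<in> sublevel n P1 \<gamma>" if v: "v \<in> sublevel n P1 \<gamma>" for v
  proof -
    have vc: "v \<in> carrier_vec n" and V: "lyap P1 v \<le> \<gamma>"
      using v by (auto simp: sublevel_def)
    \<comment> \<open>The inclusion of the sublevel set in \<open>Qset\<close> extends the
      disturbance bound from the experiment to the current state.\<close>
    have "eucl_norm (d v) \<le> \<delta>"
      using d_bound(3) sublevel_subset v by blast
    note F_le = lyap_F[OF vc this]
    have "lyap P1 (?F v) \<le> \<gamma>"
    \<comment> \<open>On \<open>\<X>\<close> the added terms are nonpositive, so the Lyapunov
      function does not grow; off \<open>\<X>\<close> the state lies in \<open>\<Z>\<close>, where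
      \<open>decrease\<close> bounds the whole sum by \<open>\<gamma>\<close>.\<close>
    proof (cases "v \<in> \<X>")
      case True
      then show ?thesis using F_le V by (simp add: X_set)
    next
      case False
      then show ?thesis using F_le decrease[of v] v vc by (simp add: Z_set)
    qed
    moreover have "?F v \<in> carrier_vec n"
      using E by (intro carrier_vecI) simp
    ultimately show ?thesis by (simp add: sublevel_def)
  qed
  show ?thesis
    unfolding positively_invariant_def
  proof (intro allI impI)
    fix y :: "nat \<Rightarrow> real vec" and t :: nat
    assume "y 0 \<in> sublevel n P1 \<gamma>" "\<forall>t. y (Suc t) = ?F (y t)"
    then show "y t \<in> sublevel n P1 \<gamma>"
      by (induction t) (simp_all add: step)
  qed
qed

end
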